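(* Let $p_1<p_2<\dots<p_N$ ($N\ge 3$) and $q_1,\dots,q_N$ be real numbers, let $I=[p_1,p_N]$, let $m\ge 1$ be an integer, and let $\alpha_1,\dots,\alpha_{N-1}\in(-1,1)$. Let $g:I\to\mathbb{R}$ be the piecewise linear interpolant of the data, let $S_i(p)=a_ip+b_i$ be the affine map with $S_i(p_1)=p_i$, $S_i(p_N)=p_{i+1}$, and let $$w_i(p,q)=\bigl(S_i(p),\ \alpha_i q+g(S_i(p))-\alpha_i B_m(g,p)\bigr),\qquad (p,q)\in I\times\mathbb{R},\quad i=1,\dots,N-1,$$ where $B_m(g,\cdot)$ is the $m$-th Bernstein polynomial of $g$ on $I$. Suppose the iterated function system $\{I\times\mathbb{R};\,w_1,\dots,w_{N-1}\}$ is hyperbolic, and let $G_1$ be its attractor. Then there exists a continuous function $\psi:I\to\mathbb{R}$ such that $\psi(p_i)=q_i$ for $i=1,2,\dots,N$ and $G_1$ is the graph of $\psi$.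
   Context: The piecewise linear interpolant $g$ is the continuous function on $I=[p_1,p_N]$ that is affine on each $[p_i,p_{i+1}]$ and satisfies $g(p_i)=q_i$ for all $i$. The $m$-th Bernstein polynomial of $g$ on $I$ is $$B_m(g,p)=\frac{1}{(p_N-p_1)^m}\sum_{v=0}^m\binom{m}{v}(p-p_1)^v(p_N-p)^{m-v}\,g\Bigl(p_1+\frac{v(p_N-p_1)}{m}\Bigr).$$ An iterated function system (IFS) on $I\times\mathbb{R}$, i.e. a finite family of maps $w_i:I\times\mathbb{R}\to I\times\mathbb{R}$, is hyperbolic if there is a complete metric on $I\times\mathbb{R}$ inducing the Euclidean topology with respect to which every $w_i$ is a contraction (Lipschitz with constant $<1$). Its attractor is the unique nonempty compact set $G\subset I\times\mathbb{R}$ with $G=\bigcup_i w_i(G)$. *)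

theory Defs
  imports "HOL-Analysis.Analysis"
begin

text \<open>The interpolant is pinned down only on the interval from \<open>p 1\<close> to \<open>p N\<close>; its values
  outside that interval are arbitrary and never matter below.\<close>

definition piecewise_linear_interpolant ::
  "nat \<Rightarrow> (nat \<Rightarrow> real) \<Rightarrow> (nat \<Rightarrow> real) \<Rightarrow> (real \<Rightarrow> real) \<Rightarrow> bool" where
  "piecewise_linear_interpolant N p q g \<longleftrightarrow>
     continuous_on {p 1..p N} g \<and>
     (\<forall>i\<in>{1..<N}. \<exists>c d. \<forall>x\<in>{p i..p (i + 1)}. g x = c * x + d) \<and>
     (\<forall>i\<in>{1..N}. g (p i) = q i)"

text \<open>The constant \<open>Bernstein\<close> of HOL-Analysis is a single basis polynomial on the unit interval;
  this is the Bernstein polynomial of a function on the interval from \<open>l\<close> to \<open>r\<close>.\<close>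

definition bernstein_poly :: "real \<Rightarrow> real \<Rightarrow> nat \<Rightarrow> (real \<Rightarrow> real) \<Rightarrow> real \<Rightarrow> real" where
  "bernstein_poly l r m g x =
     1 / (r - l) ^ m *
     (\<Sum>v=0..m. real (m choose v) * (x - l) ^ v * (r - x) ^ (m - v)
                  * g (l + real v * (r - l) / real m))"

definition ifs :: "'a set \<Rightarrow> 'i set \<Rightarrow> ('i \<Rightarrow> 'a \<Rightarrow> 'a) \<Rightarrow> bool" where
  "ifs X J w \<longleftrightarrow> finite J \<and> (\<forall>i\<in>J. w i \<in> X \<rightarrow> X)"

definition hyperbolic_ifs ::
  "'a::topological_space set \<Rightarrow> 'i set \<Rightarrow> ('i \<Rightarrow> 'a \<Rightarrow> 'a) \<Rightarrow> bool" where
  "hyperbolic_ifs X J w \<longleftrightarrow> ifs X J w \<and>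
     (\<exists>M. mspace M = X \<and> mtopology_of M = top_of_set X \<and> mcomplete_of M \<and>
          (\<forall>i\<in>J. \<exists>c\<in>{0..<1}. \<forall>x\<in>X. \<forall>y\<in>X. mdist M (w i x) (w i y) \<le> c * mdist M x y))"

definition ifs_attractor ::
  "'a::topological_space set \<Rightarrow> 'i set \<Rightarrow> ('i \<Rightarrow> 'a \<Rightarrow> 'a) \<Rightarrow> 'a set" where
  "ifs_attractor X J w =
     (THE G. G \<noteq> {} \<and> compact G \<and> G \<subseteq> X \<and> G = (\<Union>i\<in>J. w i ` G))"

end

theory Submission
  imports Defs
begin

text \<open>
  Since the Bernstein polynomial \<open>B\<close> interpolates \<open>g\<close> at both endpoints, \<open>g - B\<close> extends by zero
  to a continuous function \<open>H\<close> on the line. Writing \<open>\<psi> = g + \<phi>\<close>, the graph of \<open>\<psi>\<close> is invariant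
  iff \<open>\<phi> \<circ> S\<^sub>i = \<alpha>\<^sub>i (\<phi> + H)\<close> for all \<open>i\<close>. Among functions vanishing outside the open interval this
  is the fixed point equation of \<open>\<phi> \<mapsto> (\<Sum>i. \<alpha>\<^sub>i (\<phi> + H) \<circ> S\<^sub>i\<^sup>-\<^sup>1)\<close>, whose summands have disjoint
  supports, so that the operator preserves continuity and contracts the sup norm by
  \<open>max \<bar>\<alpha>\<^sub>i\<bar>\<close>. Conversely, for a compact invariant set the maximal vertical distance to the graph
  is multiplied by at most \<open>max \<bar>\<alpha>\<^sub>i\<bar> < 1\<close> under the maps and hence is zero, and its projection
  is the whole interval by the same argument, now for the distance to the projection under the
  contractions \<open>S\<^sub>i\<close>, whose images cover the interval.
\<close>

section \<open>Bernstein polynomials at the endpoints of the interval\<close>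

lemma bernstein_poly_left:
  assumes "l < r"
  shows "bernstein_poly l r m g l = g l"
proof -
  have "(\<Sum>v=0..m. real (m choose v) * (l - l) ^ v * (r - l) ^ (m - v)
          * g (l + real v * (r - l) / real m))
      = (\<Sum>v\<in>{0}. real (m choose v) * (l - l) ^ v * (r - l) ^ (m - v)
          * g (l + real v * (r - l) / real m))"
    by (rule sum.mono_neutral_right) auto
  with assms show ?thesis
    by (simp add: bernstein_poly_def)
qed

text \<open>Only the term \<open>v = m\<close> survives. With \<open>m \<ge> 1\<close> its node is
  \<open>r\<close>; for \<open>m = 0\<close> division by zero would turn the only node into
  \<open>l\<close>.\<close>

lemma bernstein_poly_right:
  assumes "l < r" "m \<ge> 1"
  shows "bernstein_poly l r m g r = g r"
proof -
  have "(\<Sum>v=0..m. real (m choose v) * (r - l) ^ v * (r - r) ^ (m - v)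
          * g (l + real v * (r - l) / real m))
      = (\<Sum>v\<in>{m}. real (m choose v) * (r - l) ^ v * (r - r) ^ (m - v)
          * g (l + real v * (r - l) / real m))"
    by (rule sum.mono_neutral_right) auto
  with assms show ?thesis
    by (simp add: bernstein_poly_def)
qed

lemma continuous_on_bernstein_poly: "continuous_on A (bernstein_poly l r m g)"
  unfolding bernstein_poly_def[abs_def] by (intro continuous_intros)

section \<open>Self-similar functions by Banach's fixed point theorem\<close>

lemma finite_uniform_bound_lt_1:
  fixes f :: "'i \<Rightarrow> real"
  assumes "finite J" "\<And>i. i \<in> J \<Longrightarrow> f i < 1"
  obtains c where "0 \<le> c" "c < 1" "\<And>i. i \<in> J \<Longrightarrow> f i \<le> c"
proof
  \<comment> \<open>The inserted \<open>0\<close> covers an empty \<open>J\<close> and makes the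
    bound nonnegative.\<close>
  let ?c = "Max (insert 0 (f ` J))"
  show "0 \<le> ?c" "?c < 1" "\<And>i. i \<in> J \<Longrightarrow> f i \<le> ?c"
    using assms by auto
qed

text \<open>Neighbouring images of the closed interval may share an endpoint, so \<open>disj\<close>
  compares a closed image with an open one only. This suffices because \<open>\<phi>\<close> and
  \<open>H\<close> vanish at \<open>l\<close> and \<open>r\<close>: at a shared endpoint every
  summand is zero.\<close>

lemma affine_self_similar_function:
  fixes H :: "real \<Rightarrow> real" and a b \<alpha> :: "'i \<Rightarrow> real"
  assumes J: "finite J"
    and H: "continuous_on UNIV H" "\<And>x. x \<notin> {l<..<r} \<Longrightarrow> H x = 0"
    and a: "\<And>i. i \<in> J \<Longrightarrow> a i > 0"
    and \<alpha>: "\<And>i. i \<in> J \<Longrightarrow> \<bar>\<alpha> i\<bar> < 1"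
    and inside: "\<And>i x. i \<in> J \<Longrightarrow> x \<in> {l<..<r} \<Longrightarrow> a i * x + b i \<in> {l<..<r}"
    and disj: "\<And>i j x y. i \<in> J \<Longrightarrow> j \<in> J \<Longrightarrow> i \<noteq> j \<Longrightarrow> x \<in> {l..r} \<Longrightarrow> y \<in> {l<..<r} \<Longrightarrow>
                 a i * x + b i \<noteq> a j * y + b j"
  obtains \<phi> where "continuous_on UNIV \<phi>" "\<And>x. x \<notin> {l<..<r} \<Longrightarrow> \<phi> x = 0"
    "\<And>i x. i \<in> J \<Longrightarrow> x \<in> {l..r} \<Longrightarrow> \<phi> (a i * x + b i) = \<alpha> i * (\<phi> x + H x)"
proof -
  obtain c where c: "0 \<le> c" "c < 1" "\<And>i. i \<in> J \<Longrightarrow> \<bar>\<alpha> i\<bar> \<le> c"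
    using finite_uniform_bound_lt_1[OF J, of "\<lambda>i. \<bar>\<alpha> i\<bar>"] \<alpha> by blast
  define Z :: "(real \<Rightarrow>\<^sub>C real) set" where "Z = {f. \<forall>x. x \<notin> {l<..<r} \<longrightarrow> apply_bcontfun f x = 0}"
  \<comment> \<open>A sum over all \<open>i\<close> on the whole line, instead of a definition by
    cases on the images, makes continuity of \<open>T f\<close> immediate, with no gluing at the
    nodes.\<close>
  define T where "T f t = (\<Sum>i\<in>J. \<alpha> i * (f ((t - b i) / a i) + H ((t - b i) / a i)))"
    for f :: "real \<Rightarrow> real" and t
  have T_image: "T f (a i * x + b i) = \<alpha> i * (f x + H x)"
    if "i \<in> J" "x \<in> {l..r}" and f0: "\<And>y. y \<notin> {l<..<r} \<Longrightarrow> f y = 0" for f i x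
  proof -
    have zero: "f y = 0 \<and> H y = 0" if j: "j \<in> J - {i}" "y = (a i * x + b i - b j) / a j" for j y
    proof -
      have "a j * y + b j = a i * x + b i"
        using j a[of j] by (auto simp: field_simps)
      then have "y \<notin> {l<..<r}"
        using disj[of i j x y] \<open>i \<in> J\<close> \<open>x \<in> {l..r}\<close> j by auto
      then show ?thesis
        using H(2) f0 by blast
    qed
    have "T f (a i * x + b i) = (\<Sum>j\<in>{i}. \<alpha> j * (f ((a i * x + b i - b j) / a j)
            + H ((a i * x + b i - b j) / a j)))"
      unfolding T_def
      by (rule sum.mono_neutral_right) (use J \<open>i \<in> J\<close> zero in auto)
    then show ?thesis
      using a[OF \<open>i \<in> J\<close>] by simp
  qed
  have T_zero: "T f t = 0"
    if "\<And>i x. i \<in> J \<Longrightarrow> x \<in> {l<..<r} \<Longrightarrow> t \<noteq> a i * x + b i" "\<And>y. y \<notin> {l<..<r} \<Longrightarrow> f y = 0" for f t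
    unfolding T_def
  proof (intro sum.neutral ballI)
    fix i assume i: "i \<in> J"
    have "t = a i * ((t - b i) / a i) + b i"
      using a[OF i] by simp
    then have "(t - b i) / a i \<notin> {l<..<r}"
      using that(1)[OF i] by blast
    then show "\<alpha> i * (f ((t - b i) / a i) + H ((t - b i) / a i)) = 0"
      using that(2) H(2) by simp
  qed
  \<comment> \<open>\<open>Bcontfun\<close> can be inverted only on bounded continuous functions.
    Boundedness holds because \<open>T f\<close> is continuous and vanishes outside the compact
    interval.\<close>
  have T_bcont: "T (apply_bcontfun f) \<in> bcontfun" if f: "f \<in> Z" for f
  proof -
    have cont: "continuous_on UNIV (T (apply_bcontfun f))"
      unfolding T_def
      by (intro continuous_intros continuous_on_compose2[OF H(1)]
            continuous_on_compose2[OF continuous_on_apply_bcontfun]) (auto dest: a)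
    have "bounded (T (apply_bcontfun f) ` {l..r})"
      by (intro compact_imp_bounded compact_continuous_image continuous_on_subset[OF cont]) auto
    moreover have "T (apply_bcontfun f) x = 0" if "x \<notin> {l..r}" for x
      by (rule T_zero) (use f inside that in \<open>fastforce simp: Z_def\<close>)+
    then have "range (T (apply_bcontfun f)) \<subseteq> insert 0 (T (apply_bcontfun f) ` {l..r})"
      by blast
    ultimately have "bounded (range (T (apply_bcontfun f)))"
      using bounded_insert bounded_subset by blast
    with cont show ?thesis
      by (simp add: bcontfun_def)
  qed
  have fun_T: "apply_bcontfun (Bcontfun (T (apply_bcontfun f))) = T (apply_bcontfun f)" if "f \<in> Z" for f
    using T_bcont[OF that] by (simp add: Bcontfun_inverse)
  have "closed Z"
  proof -
    have "Z = PiC UNIV (\<lambda>x. if x \<in> {l<..<r} then UNIV else {0})"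
      by (auto simp: Z_def mem_PiC_iff Pi_iff split: if_splits)
    then show ?thesis
      by (simp add: closed_PiC)
  qed
  have "\<exists>!f. f \<in> Z \<and> Bcontfun (T (apply_bcontfun f)) = f"
  proof (rule Banach_fix[OF _ _ c(1,2)])
    show "complete Z"
      using \<open>closed Z\<close> by (simp add: complete_eq_closed)
    have "0 \<in> Z"
      by (simp add: Z_def)
    then show "Z \<noteq> {}"
      by blast
    show "(\<lambda>f. Bcontfun (T (apply_bcontfun f))) ` Z \<subseteq> Z"
    proof (rule image_subsetI)
      fix f assume f: "f \<in> Z"
      have "T (apply_bcontfun f) x = 0" if "x \<notin> {l<..<r}" for x
        by (rule T_zero) (use f inside that in \<open>auto simp: Z_def\<close>)
      then show "Bcontfun (T (apply_bcontfun f)) \<in> Z"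
        using fun_T[OF f] by (simp add: Z_def)
    qed
    fix f f' assume f: "f \<in> Z" "f' \<in> Z"
    show "dist (Bcontfun (T (apply_bcontfun f))) (Bcontfun (T (apply_bcontfun f'))) \<le> c * dist f f'"
    proof (rule dist_bound, goal_cases)
      case (1 t)
      show ?case
      \<comment> \<open>On an open image a single summand counts and \<open>H\<close> cancels in the
        difference; elsewhere both values are zero.\<close>
      proof (cases "\<exists>i\<in>J. \<exists>x\<in>{l<..<r}. t = a i * x + b i")
        case True
        then obtain i x where ix: "i \<in> J" "x \<in> {l<..<r}" "t = a i * x + b i"
          by blast
        have "T (apply_bcontfun f) t = \<alpha> i * (f x + H x)" "T (apply_bcontfun f') t = \<alpha> i * (f' x + H x)"
          unfolding ix(3) by (rule T_image; use ix f in \<open>auto simp: Z_def\<close>)+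
        then have "dist (T (apply_bcontfun f) t) (T (apply_bcontfun f') t) = \<bar>\<alpha> i\<bar> * dist (f x) (f' x)"
          by (simp add: dist_real_def algebra_simps flip: abs_mult)
        also have "\<dots> \<le> c * dist f f'"
          by (intro mult_mono c dist_bounded ix) (use c in auto)
        finally show ?thesis
          by (simp add: fun_T f)
      next
        case False
        then have "T (apply_bcontfun f) t = 0" "T (apply_bcontfun f') t = 0"
          using f by (auto intro!: T_zero simp: Z_def)
        then show ?thesis
          by (simp add: fun_T f c)
      qed
    qed
  qed
  then obtain f where f: "f \<in> Z" "T (apply_bcontfun f) = apply_bcontfun f"
    using fun_T by metis
  show ?thesis
  proof
    show "continuous_on UNIV (apply_bcontfun f)"
      by simp
    show zero: "f x = 0" if "x \<notin> {l<..<r}" for x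
      using f(1) that by (auto simp: Z_def)
    show "f (a i * x + b i) = \<alpha> i * (f x + H x)" if "i \<in> J" "x \<in> {l..r}" for i x
      using T_image[OF that, of f] f(2) zero by simp
  qed
qed

section \<open>Uniqueness of compact invariant sets\<close>

text \<open>Let \<open>x\<close> be a point of \<open>I\<close> farthest from \<open>K\<close>,
  \<open>x = S i x'\<close>, and \<open>k\<close> a point of \<open>K\<close> nearest to
  \<open>x'\<close>. Since \<open>S i k\<close> is in \<open>K\<close>, the maximal distance is at
  most \<open>c < 1\<close> times itself.\<close>

lemma invariant_subset_eq:
  fixes I K :: "'a::heine_borel set"
  assumes J: "finite J" and I: "compact I" "I \<subseteq> (\<Union>i\<in>J. S i ` I)"
    and K: "compact K" "K \<noteq> {}" "K \<subseteq> I" "(\<Union>i\<in>J. S i ` K) \<subseteq> K"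
    and a: "\<And>i. i \<in> J \<Longrightarrow> a i < 1"
    and S: "\<And>i x y. i \<in> J \<Longrightarrow> x \<in> I \<Longrightarrow> y \<in> I \<Longrightarrow> dist (S i x) (S i y) \<le> a i * dist x y"
  shows "K = I"
proof -
  obtain c where c: "0 \<le> c" "c < 1" "\<And>i. i \<in> J \<Longrightarrow> a i \<le> c"
    using finite_uniform_bound_lt_1[OF J, of a] a by blast
  have "continuous_on I (\<lambda>x. infdist x K)"
    by (intro continuous_intros)
  then obtain x where x: "x \<in> I" "\<And>y. y \<in> I \<Longrightarrow> infdist y K \<le> infdist x K"
    using continuous_attains_sup[OF I(1)] K by (metis subset_empty)
  obtain i x' where i: "i \<in> J" "x' \<in> I" "x = S i x'"
    using I(2) x(1) by blast
  obtain k where k: "k \<in> K" "infdist x' K = dist x' k"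
    using infdist_attains_inf[OF compact_imp_closed[OF K(1)] K(2)] by metis
  have "infdist x K \<le> dist (S i x') (S i k)"
    unfolding i(3) by (rule infdist_le) (use K(4) k i in blast)
  also have "\<dots> \<le> a i * dist x' k"
    using S i k K(3) by blast
  also have "\<dots> \<le> c * dist x' k"
    using c(3)[OF i(1)] by (intro mult_right_mono) auto
  also have "\<dots> \<le> c * infdist x K"
    using x(2)[OF i(2)] k(2) c(1) by (simp add: mult_left_mono)
  finally have "(1 - c) * infdist x K \<le> 0"
    by (simp add: algebra_simps)
  with c(2) have "infdist x K \<le> 0"
    by (simp add: mult_le_0_iff)
  then have "infdist y K = 0" if "y \<in> I" for y
    using x(2)[OF that] infdist_nonneg[of y K] by linarith
  then show ?thesis
    using in_closed_iff_infdist_zero[OF compact_imp_closed[OF K(1)] K(2)] K(3) by blast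
qed

text \<open>The offset \<open>d i x\<close> occurs both in \<open>w i (x, y)\<close> and in
  \<open>\<psi> (S i x)\<close>, so it cancels in the vertical distance to the graph, which is thus
  scaled by exactly \<open>\<bar>\<alpha> i\<bar>\<close>.\<close>

lemma invariant_set_eq_graph:
  fixes \<psi> :: "'a::heine_borel \<Rightarrow> real"
  assumes J: "finite J" and I: "compact I" "I = (\<Union>i\<in>J. S i ` I)"
    and a: "\<And>i. i \<in> J \<Longrightarrow> a i < 1"
    and S: "\<And>i x y. i \<in> J \<Longrightarrow> x \<in> I \<Longrightarrow> y \<in> I \<Longrightarrow> dist (S i x) (S i y) \<le> a i * dist x y"
    and \<alpha>: "\<And>i. i \<in> J \<Longrightarrow> \<bar>\<alpha> i\<bar> < 1"
    and w: "\<And>i x y. i \<in> J \<Longrightarrow> x \<in> I \<Longrightarrow> w i (x, y) = (S i x, \<alpha> i * y + d i x)"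
    and \<psi>: "continuous_on I \<psi>"
      "\<And>i x. i \<in> J \<Longrightarrow> x \<in> I \<Longrightarrow> \<psi> (S i x) = \<alpha> i * \<psi> x + d i x"
    and G: "compact G" "G \<noteq> {}" "G \<subseteq> I \<times> UNIV" "G = (\<Union>i\<in>J. w i ` G)"
  shows "G = (\<lambda>x. (x, \<psi> x)) ` I"
proof -
  obtain c where c: "0 \<le> c" "c < 1" "\<And>i. i \<in> J \<Longrightarrow> \<bar>\<alpha> i\<bar> \<le> c"
    using finite_uniform_bound_lt_1[OF J, of "\<lambda>i. \<bar>\<alpha> i\<bar>"] \<alpha> by blast
  have "continuous_on G (\<lambda>z. \<psi> (fst z))"
    by (rule continuous_on_compose2[OF \<psi>(1)]) (use G(3) in \<open>auto intro: continuous_intros\<close>)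
  then have "continuous_on G (\<lambda>z. \<bar>snd z - \<psi> (fst z)\<bar>)"
    by (intro continuous_intros)
  from continuous_attains_sup[OF G(1,2) this] obtain z where z: "z \<in> G" "\<And>z'. z' \<in> G \<Longrightarrow> \<bar>snd z' - \<psi> (fst z')\<bar> \<le> \<bar>snd z - \<psi> (fst z)\<bar>"
    by blast
  \<comment> \<open>The maximizer \<open>z\<close> is itself an image of a point of
    \<open>G\<close>, whose vertical distance is no larger.\<close>
  obtain i x y where i: "i \<in> J" "(x, y) \<in> G" "z = w i (x, y)"
    using z(1) equalityD1[OF G(4)] by auto
  have "x \<in> I"
    using i(2) G(3) by blast
  then have "\<bar>snd z - \<psi> (fst z)\<bar> = \<bar>\<alpha> i\<bar> * \<bar>y - \<psi> x\<bar>"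
    using i by (simp add: w \<psi>(2) algebra_simps flip: abs_mult)
  also have "\<dots> \<le> c * \<bar>snd z - \<psi> (fst z)\<bar>"
    using z(2)[OF i(2)] c i(1) by (intro mult_mono) auto
  finally have "(1 - c) * \<bar>snd z - \<psi> (fst z)\<bar> \<le> 0"
    by (simp add: algebra_simps)
  with c(2) have "\<bar>snd z - \<psi> (fst z)\<bar> \<le> 0"
    by (simp add: mult_le_0_iff)
  then have on_graph: "y = \<psi> x" if "(x, y) \<in> G" for x y
    using z(2)[OF that] by simp
  \<comment> \<open>So far \<open>G\<close> is only a subset of the graph; a full projection makes
    it the whole graph.\<close>
  have "fst ` G = I"
  proof (rule invariant_subset_eq[where S = S and a = a, OF J I(1)])
    show "I \<subseteq> (\<Union>i\<in>J. S i ` I)"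
      by (rule equalityD1[OF I(2)])
    show "compact (fst ` G)"
      by (intro compact_continuous_image continuous_intros G)
    show "fst ` G \<noteq> {}" "fst ` G \<subseteq> I"
      using G(2,3) by auto
    show "(\<Union>i\<in>J. S i ` fst ` G) \<subseteq> fst ` G"
    proof clarsimp
      fix i x y assume i: "i \<in> J" "(x, y) \<in> G"
      then have "w i (x, y) \<in> G"
        using equalityD2[OF G(4)] by blast
      then show "S i x \<in> fst ` G"
        using w[of i x y] i G(3) by force
    qed
  qed (use a S in auto)
  show ?thesis
  proof (intro equalityI subsetI)
    fix z assume "z \<in> G"
    then show "z \<in> (\<lambda>x. (x, \<psi> x)) ` I"
      using on_graph[of "fst z" "snd z"] \<open>fst ` G = I\<close> by (intro image_eqI[of _ _ "fst z"]) (auto simp: prod_eq_iff)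
  next
    fix z assume "z \<in> (\<lambda>x. (x, \<psi> x)) ` I"
    then obtain x y where "(x, y) \<in> G" "z = (x, \<psi> x)"
      using \<open>fst ` G = I\<close> by fastforce
    with on_graph show "z \<in> G"
      by blast
  qed
qed

text \<open>The existence half of the characterization of the attractor, complementing
  \<open>invariant_set_eq_graph\<close>.\<close>

lemma graph_invariant:
  assumes "I = (\<Union>i\<in>J. S i ` I)"
    and "\<And>i x y. i \<in> J \<Longrightarrow> x \<in> I \<Longrightarrow> w i (x, y) = (S i x, \<alpha> i * y + d i x)"
    and "\<And>i x. i \<in> J \<Longrightarrow> x \<in> I \<Longrightarrow> \<psi> (S i x) = \<alpha> i * \<psi> x + d i x"
  shows "(\<lambda>x. (x, \<psi> x)) ` I = (\<Union>i\<in>J. w i ` (\<lambda>x. (x, \<psi> x)) ` I)"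
proof -
  have "(\<Union>i\<in>J. w i ` (\<lambda>x. (x, \<psi> x)) ` I) = (\<Union>i\<in>J. (\<lambda>x. (x, \<psi> x)) ` S i ` I)"
    by (intro SUP_cong refl) (auto simp: image_image assms(2,3) intro!: image_cong)
  also have "\<dots> = (\<lambda>x. (x, \<psi> x)) ` I"
    by (subst (2) assms(1)) (simp add: image_UN)
  finally show ?thesis ..
qed

section \<open>The interpolation data and the attractor\<close>

lemma between_consecutive_nodes:
  fixes p :: "nat \<Rightarrow> 'a::linorder"
  assumes "1 < n" "p 1 \<le> x" "x \<le> p n"
  shows "\<exists>i\<in>{1..<n}. p i \<le> x \<and> x \<le> p (i + 1)"
  using assms
proof (induction n)
  case (Suc n)
  show ?case
  proof (cases "1 < n \<and> x \<le> p n")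
    case True
    with Suc show ?thesis by force
  next
    case False
    with Suc.prems show ?thesis
      by (intro bexI[of _ n]) (auto simp: not_less le_less_Suc_eq le_Suc_eq)
  qed
qed simp

theorem theorem3p1:
  fixes N m :: nat
    and p q \<alpha> a b :: "nat \<Rightarrow> real"
    and g :: "real \<Rightarrow> real"
    and S :: "nat \<Rightarrow> real \<Rightarrow> real"
    and w :: "nat \<Rightarrow> real \<times> real \<Rightarrow> real \<times> real"
    and I :: "real set"
    and G1 :: "(real \<times> real) set"
  assumes "N \<ge> 3"
    and "strict_mono_on {1..N} p"
    and "I = {p 1..p N}"
    and "m \<ge> 1"
    and "\<And>i. i \<in> {1..<N} \<Longrightarrow> \<alpha> i \<in> {-1<..<1}"
    and "piecewise_linear_interpolant N p q g"
    and "\<And>i x. i \<in> {1..<N} \<Longrightarrow> S i x = a i * x + b i"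
    and "\<And>i. i \<in> {1..<N} \<Longrightarrow> S i (p 1) = p i"
    and "\<And>i. i \<in> {1..<N} \<Longrightarrow> S i (p N) = p (i + 1)"
    and "\<And>i x y. i \<in> {1..<N} \<Longrightarrow> x \<in> I \<Longrightarrow>
           w i (x, y) = (S i x, \<alpha> i * y + g (S i x) - \<alpha> i * bernstein_poly (p 1) (p N) m g x)"
    and "hyperbolic_ifs (I \<times> UNIV) {1..<N} w"
    and "G1 = ifs_attractor (I \<times> UNIV) {1..<N} w"
  shows "\<exists>\<psi> :: real \<Rightarrow> real. continuous_on I \<psi> \<and> (\<forall>i\<in>{1..N}. \<psi> (p i) = q i) \<and>
           G1 = {(x, \<psi> x) | x. x \<in> I}"
proof -
  let ?l = "p 1" and ?r = "p N" and ?J = "{1..<N}"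
  let ?B = "bernstein_poly (p 1) (p N) m g"
  define d where "d i x = g (S i x) - \<alpha> i * ?B x" for i x
  note mono = assms(2) and I = assms(3) and S = assms(7) and S_left = assms(8) and S_right = assms(9)
  have g: "continuous_on I g" "\<And>i. i \<in> {1..N} \<Longrightarrow> g (p i) = q i"
    using assms(3,6) by (auto simp: piecewise_linear_interpolant_def)
  have w: "w i (x, y) = (S i x, \<alpha> i * y + d i x)" if "i \<in> ?J" "x \<in> I" for i x y
    using assms(10)[OF that] by (simp add: d_def)
  have \<alpha>: "\<bar>\<alpha> i\<bar> < 1" if "i \<in> ?J" for i
    using assms(5)[OF that] by auto
  have p_less: "p i < p j" if "1 \<le> i" "i < j" "j \<le> N" for i j
    using that by (intro strict_mono_onD[OF mono]) auto
  have p_le: "p i \<le> p j" if "1 \<le> i" "i \<le> j" "j \<le> N" for i j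
    using p_less[of i j] that by (cases "i = j") auto
  have lr: "?l < ?r"
    using p_less[of 1 N] \<open>N \<ge> 3\<close> by simp
  have a_eq: "a i * (?r - ?l) = p (i + 1) - p i" if "i \<in> ?J" for i
    using S[OF that] S_left[OF that] S_right[OF that] by (simp add: algebra_simps)
  have a_pos: "a i > 0" if "i \<in> ?J" for i
  proof -
    have "0 < a i * (?r - ?l)"
      unfolding a_eq[OF that] using p_less[of i "i + 1"] that by simp
    then show ?thesis
      using lr by (simp add: zero_less_mult_iff)
  qed
  have a_less_1: "a i < 1" if "i \<in> ?J" for i
  proof -
    \<comment> \<open>With \<open>N \<ge> 3\<close> there are at least two subintervals, so each is
      strictly shorter than \<open>I\<close>.\<close>
    have "i \<noteq> 1 \<or> i + 1 \<noteq> N"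
      using \<open>N \<ge> 3\<close> by auto
    then have "p (i + 1) - p i < ?r - ?l"
      using that p_le[of 1 i] p_less[of 1 i] p_le[of "i + 1" N] p_less[of "i + 1" N]
      by (cases "i = 1"; cases "i + 1 = N") auto
    then show ?thesis
      using lr unfolding a_eq[OF that, symmetric] by simp
  qed
  have S_mono: "S i x \<le> S i y \<longleftrightarrow> x \<le> y" if "i \<in> ?J" for i x y
    using a_pos[OF that] by (simp add: S[OF that])
  have S_less: "S i x < S i y \<longleftrightarrow> x < y" if "i \<in> ?J" for i x y
    using a_pos[OF that] by (simp add: S[OF that])
  have S_closed: "S i x \<in> {p i..p (i + 1)}" if "i \<in> ?J" "x \<in> I" for i x
    using S_mono[OF that(1), of ?l x] S_mono[OF that(1), of x ?r] that(2)
    by (simp add: I S_left[OF that(1)] S_right[OF that(1)] del: One_nat_def)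
  have S_open: "S i x \<in> {p i<..<p (i + 1)}" if "i \<in> ?J" "x \<in> {?l<..<?r}" for i x
    using S_less[OF that(1), of ?l x] S_less[OF that(1), of x ?r] that(2)
    by (simp add: S_left[OF that(1)] S_right[OF that(1)] del: One_nat_def)
  have S_I: "S i x \<in> I" if "i \<in> ?J" "x \<in> I" for i x
    using S_closed[OF that] that p_le[of 1 i] p_le[of "i + 1" N] by (auto simp: I)
  have I_eq: "I = (\<Union>i\<in>?J. S i ` I)"
  proof (intro equalityI subsetI)
    fix x assume "x \<in> I"
    then obtain i where i: "i \<in> ?J" "p i \<le> x" "x \<le> p (i + 1)"
      using between_consecutive_nodes[of N p x] \<open>N \<ge> 3\<close> by (auto simp: I)
    have x: "S i ((x - b i) / a i) = x"
      using a_pos[OF i(1)] by (simp add: S[OF i(1)])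
    have "(x - b i) / a i \<in> I"
      using S_mono[OF i(1), of ?l "(x - b i) / a i"] S_mono[OF i(1), of "(x - b i) / a i" ?r] i
      by (simp add: I x S_left[OF i(1)] S_right[OF i(1)] del: One_nat_def)
    with x i(1) show "x \<in> (\<Union>i\<in>?J. S i ` I)"
      by force
  qed (use S_I in auto)

  \<comment> \<open>Nothing is known about \<open>g\<close> outside \<open>I\<close>, so the
    argument is clamped to \<open>I\<close>. As \<open>?B\<close> agrees with \<open>g\<close> at
    both endpoints, this is the extension of \<open>g - ?B\<close> by zero.\<close>
  define H where "H x = (let y = max ?l (min ?r x) in g y - ?B y)" for x
  have H_I: "H x = g x - ?B x" if "x \<in> I" for x
    using that by (simp add: H_def I)
  have "continuous_on UNIV H"
    unfolding H_def Let_def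
    by (intro continuous_intros continuous_on_compose2[OF g(1)]
          continuous_on_compose2[OF continuous_on_bernstein_poly[of UNIV]]) (use lr in \<open>auto simp: I\<close>)
  moreover have "H x = 0" if "x \<notin> {?l<..<?r}" for x
  proof -
    have "max ?l (min ?r x) = ?l \<or> max ?l (min ?r x) = ?r"
      using that lr by auto
    then show ?thesis
      using bernstein_poly_left[OF lr] bernstein_poly_right[OF lr \<open>m \<ge> 1\<close>] by (auto simp: H_def)
  qed
  moreover have "a i * x + b i \<in> {?l<..<?r}" if "i \<in> ?J" "x \<in> {?l<..<?r}" for i x
    using S_open[OF that] that p_le[of 1 i] p_le[of "i + 1" N] by (auto simp: S[OF that(1)])
  moreover have "a i * x + b i \<noteq> a j * y + b j"
    if "i \<in> ?J" "j \<in> ?J" "i \<noteq> j" "x \<in> {?l..?r}" "y \<in> {?l<..<?r}" for i j x y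
  proof -
    \<comment> \<open>Distinct subintervals meet in at most a node, and \<open>S j y\<close> lies
      strictly inside its own.\<close>
    have "p (i + 1) \<le> p j \<or> p (j + 1) \<le> p i"
      using that p_le[of "i + 1" j] p_le[of "j + 1" i] by (cases "i < j") auto
    then show ?thesis
      using S_closed[OF that(1), of x] S_open[OF that(2,5)] that(4)
      by (auto simp: S[OF that(1)] S[OF that(2)] I)
  qed
  ultimately obtain \<phi> where \<phi>: "continuous_on UNIV \<phi>" "\<And>x. x \<notin> {?l<..<?r} \<Longrightarrow> \<phi> x = 0"
    "\<And>i x. i \<in> ?J \<Longrightarrow> x \<in> {?l..?r} \<Longrightarrow> \<phi> (a i * x + b i) = \<alpha> i * (\<phi> x + H x)"
    using affine_self_similar_function[of ?J H ?l ?r a \<alpha> b] a_pos \<alpha> by blast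

  define \<psi> where "\<psi> x = g x + \<phi> x" for x
  have \<psi>_cont: "continuous_on I \<psi>"
    unfolding \<psi>_def by (intro continuous_intros g continuous_on_subset[OF \<phi>(1)]) auto
  \<comment> \<open>On \<open>I\<close>, \<open>\<phi> + H = \<psi> - ?B\<close>; adding
    \<open>g (S i x)\<close> to \<open>\<alpha> i * (\<psi> x - ?B x)\<close> gives the right-hand
    side.\<close>
  have \<psi>_S: "\<psi> (S i x) = \<alpha> i * \<psi> x + d i x" if "i \<in> ?J" "x \<in> I" for i x
    using \<phi>(3)[OF that(1), of x] that(2) H_I[OF that(2)]
    by (simp add: \<psi>_def d_def S[OF that(1)] I algebra_simps)
  have \<psi>_p: "\<psi> (p i) = q i" if i: "i \<in> {1..N}" for i
  proof -
    \<comment> \<open>For \<open>i < N\<close> the node is the image of the left endpoint under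
      \<open>S i\<close>, where \<open>\<phi>\<close> and \<open>g - ?B\<close> both vanish; the
      last node is the right endpoint itself.\<close>
    have "\<phi> (p i) = 0"
    proof (cases "i = N")
      case False
      then have "i \<in> ?J"
        using i by auto
      have "\<phi> (S i ?l) = \<alpha> i * (\<phi> ?l + (g ?l - ?B ?l))"
        using \<phi>(3)[OF \<open>i \<in> ?J\<close>, of ?l] H_I[of ?l] lr by (simp add: I S[OF \<open>i \<in> ?J\<close>])
      also have "\<dots> = 0"
        by (simp add: bernstein_poly_left[OF lr] \<phi>(2) del: One_nat_def)
      finally show ?thesis
        by (simp only: S_left[OF \<open>i \<in> ?J\<close>])
    qed (simp add: \<phi>(2))
    with g(2)[OF i] show ?thesis
      by (simp add: \<psi>_def)
  qed

  let ?graph = "(\<lambda>x. (x, \<psi> x)) ` I"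
  have "ifs_attractor (I \<times> UNIV) ?J w = ?graph"
    unfolding ifs_attractor_def
  \<comment> \<open>The definite description requires that the graph is a nonempty compact invariant
    set and that every such set equals it.\<close>
  proof (rule the_equality)
    have "I \<noteq> {}" "compact I"
      using lr by (auto simp: I)
    moreover have "compact ?graph"
      by (intro compact_continuous_image continuous_intros \<psi>_cont \<open>compact I\<close>)
    moreover have "?graph = (\<Union>i\<in>?J. w i ` ?graph)"
      by (rule graph_invariant[where \<alpha> = \<alpha> and d = d, OF I_eq]) (fact w \<psi>_S)+
    ultimately show "?graph \<noteq> {} \<and> compact ?graph \<and> ?graph \<subseteq> I \<times> UNIV \<and> ?graph = (\<Union>i\<in>?J. w i ` ?graph)"
      by blast
  next
    fix G assume G: "G \<noteq> {} \<and> compact G \<and> G \<subseteq> I \<times> UNIV \<and> G = (\<Union>i\<in>?J. w i ` G)"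
    have S_dist: "dist (S i x) (S i y) \<le> a i * dist x y" if "i \<in> ?J" "x \<in> I" "y \<in> I" for i x y
      using a_pos[OF that(1)] by (simp add: S[OF that(1)] dist_real_def abs_mult flip: right_diff_distrib)
    show "G = ?graph"
    proof (rule invariant_set_eq_graph[where J = ?J and S = S and a = a and \<alpha> = \<alpha> and w = w and d = d])
      show "compact G" "G \<noteq> {}" "G \<subseteq> I \<times> UNIV" "G = (\<Union>i\<in>?J. w i ` G)"
        using G by blast+
    qed (fact I_eq a_less_1 S_dist \<alpha> w \<psi>_cont \<psi>_S | simp add: I)+
  qed
  then show ?thesis
    using \<psi>_cont \<psi>_p assms(12) by (intro exI[of _ \<psi>]) auto
qed

end
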